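(* For every integer $n\ge 2$ we have $h(n)=h_k(n)$, where $k=k(n)$ is the integer defined by $\sigma_k\le n<\sigma_{k+1}$.
   Context: Let $p_i$ denote the $i$-th prime ($p_1=2$). Set $\sigma_0=0$ and $\sigma_j=p_1+p_2+\dots+p_j$ for $j\ge1$. For a squarefree positive integer $M$, $\ell(M)$ denotes the sum of the prime factors of $M$ (with $\ell(1)=0$) and $\omega(M)$ the number of prime factors of $M$. For an integer $n\ge0$, $h(n)$ is the maximum of all squarefree positive integers $M$ with $\ell(M)\le n$, i.e. the greatest product of a family of distinct primes whose sum does not exceed $n$ (so $h(0)=h(1)=1$). For $0\le j\le k(n)$ (equivalently $n\ge\sigma_j$), $h_j(n)$ is the maximum of all squarefree positive integers $M$ with $\omega(M)=j$ and $\ell(M)\le n$. *)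

theory Defs
  imports Complex_Main "HOL-Computational_Algebra.Computational_Algebra" "HOL-Library.Infinite_Set"
begin

text \<open>The primes are numbered from 1 (so that \<open>nth_prime 1 = 2\<close>), whereas
  \<^const>\<open>enumerate\<close> counts from 0; the value of \<open>nth_prime\<close> at 0 is irrelevant.\<close>

definition nth_prime :: "nat \<Rightarrow> nat" where
  "nth_prime i = enumerate {p. prime p} (i - 1)"

definition sigma :: "nat \<Rightarrow> nat" where
  "sigma j = (\<Sum>i=1..j. nth_prime i)"

definition kay :: "nat \<Rightarrow> nat" where
  "kay n = (THE k. sigma k \<le> n \<and> n < sigma (k + 1))"

text \<open>The next two functions are only meant for squarefree arguments: both run over the
  set of prime factors, without multiplicity.\<close>

definition ell :: "nat \<Rightarrow> nat" where
  "ell M = \<Sum>(prime_factors M)"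

definition omega :: "nat \<Rightarrow> nat" where
  "omega M = card (prime_factors M)"

definition max_prod :: "nat \<Rightarrow> nat" where
  "max_prod n = Max {M. 0 < M \<and> squarefree M \<and> ell M \<le> n}"

text \<open>Meaningful for \<open>sigma j \<le> n\<close> only; otherwise the set below is empty.\<close>

definition max_prod_omega :: "nat \<Rightarrow> nat \<Rightarrow> nat" where
  "max_prod_omega j n = Max {M. 0 < M \<and> squarefree M \<and> omega M = j \<and> ell M \<le> n}"

end

theory Submission
  imports Defs "HOL-Analysis.Harmonic_Numbers"
begin

text \<open>Let \<open>A\<close> be an optimal set of primes for \<open>n\<close>, and \<open>b\<close> the least prime missing from it. Replacing a prime
  \<open>c\<close> of \<open>A\<close> by \<open>b\<close> and another missing prime \<open>s\<close> must not pay off, so \<open>b + s \<le> c\<close> forces \<open>b * s < c\<close>.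
  The latter is impossible as well: for \<open>s\<close> maximal, Bertrand's postulate yields a prime \<open>q\<close> between \<open>b + s\<close>
  and \<open>b * s\<close>; if \<open>q\<close> is in \<open>A\<close>, it can be split into \<open>b\<close> and \<open>s\<close>, and otherwise \<open>q\<close> contradicts the
  maximality of \<open>s\<close>. So every missing prime other than \<open>b\<close> is larger than \<open>c - b\<close> for all \<open>c\<close> in \<open>A\<close>.
  If \<open>A\<close> had fewer than \<open>k\<close> elements, its primes beyond the \<open>k\<close>-th could therefore be moved down into
  distinct gaps below at the price of a factor smaller than \<open>b\<close>, and \<open>b\<close> could be added. Bertrand's
  postulate itself is proved following Erdos.\<close>

subsection \<open>Bertrand's postulate\<close>

lemma binomial_odd_middle_le: "(2 * m + 1) choose m \<le> 4 ^ m"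
proof -
  have "2 * ((2 * m + 1) choose m) = (\<Sum>k\<in>{m, m + 1}. (2 * m + 1) choose k)"
    using binomial_symmetric[of m "2 * m + 1"] by simp
  also have "\<dots> \<le> (\<Sum>k\<le>2 * m + 1. (2 * m + 1) choose k)"
    by (intro sum_mono2) auto
  also have "\<dots> = 2 * 4 ^ m"
    by (subst choose_row_sum) (simp add: power_mult)
  finally show ?thesis by simp
qed

lemma prod_distinct_primes_dvd:
  fixes m :: nat
  assumes "finite A" "\<And>p. p \<in> A \<Longrightarrow> prime p" "\<And>p. p \<in> A \<Longrightarrow> p dvd m"
  shows "\<Prod>A dvd m"
  using assms
proof (induction A rule: finite_induct)
  case (insert p A)
  have "coprime p (\<Prod>A)"
    by (rule prod_coprime_right) (use insert in \<open>auto intro!: primes_coprime\<close>)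
  with insert show ?case by (simp add: divides_mult)
qed simp

text \<open>For odd \<open>n = 2 * m + 1\<close> the primes above \<open>m + 1\<close> all divide
  \<open>n choose m\<close>, which is at most \<open>4 ^ m\<close>; induction covers the others. An
  even \<open>n > 2\<close> adds no prime.\<close>

lemma primorial_le: "\<Prod>{p::nat. prime p \<and> p \<le> n} \<le> 4 ^ n"
proof (induction n rule: less_induct)
  case (less n)
  let ?P = "\<lambda>n. {p::nat. prime p \<and> p \<le> n}"
  consider "n < 2" | "n = 2" | m where "n = 2 * m" "m \<ge> 2" | m where "n = 2 * m + 1" "m \<ge> 1"
  proof (cases "even n")
    case True
    then obtain m where "n = 2 * m" by (elim evenE)
    moreover consider "m = 0" | "m = 1" | "m \<ge> 2" by linarith
    ultimately show thesis using that by cases auto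
  next
    case False
    then obtain m where "n = 2 * m + 1" by (elim oddE)
    then show thesis using that by (cases "m = 0") auto
  qed
  then show ?case
  proof cases
    case 1
    then have "?P n = {}" by (auto dest: prime_ge_2_nat)
    then show ?thesis by (metis one_le_power one_le_numeral prod.empty)
  next
    case 2
    then have "?P n = {2}" by (auto dest: prime_ge_2_nat intro: antisym)
    moreover have "\<Prod>{2::nat} \<le> 4 ^ n" using 2 by simp
    ultimately show ?thesis by metis
  next
    case 3
    then have "\<not> prime n"
      using prime_odd_nat[of n] by auto
    then have "p \<le> n \<longleftrightarrow> p \<le> n - 1" if "prime p" for p
      using that 3 by (cases "p = n") auto
    then have "?P n = ?P (n - 1)" by blast
    then have "\<Prod>(?P n) \<le> 4 ^ (n - 1)"
      using less.IH[of "n - 1"] 3 by simp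
    also have "\<dots> \<le> 4 ^ n" by (rule power_increasing) auto
    finally show ?thesis .
  next
    case 4
    let ?Q = "{p. prime p \<and> m + 1 < p \<and> p \<le> n}"
    have "?P n = ?P (m + 1) \<union> ?Q" using 4 by auto
    then have "\<Prod>(?P n) = \<Prod>(?P (m + 1)) * \<Prod>?Q"
      by (simp add: prod.union_disjoint disjoint_iff)
    also have "\<Prod>(?P (m + 1)) \<le> 4 ^ (m + 1)"
      using less.IH[of "m + 1"] 4 by simp
    also have "\<Prod>?Q dvd (n choose m)"
    proof (rule prod_distinct_primes_dvd)
      fix p assume p: "p \<in> ?Q"
      have "p dvd fact n" using p by (simp add: prime_dvd_fact_iff)
      also have "fact n = fact m * fact (n - m) * (n choose m)"
        using 4 by (intro binomial_fact_lemma [symmetric]) simp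
      finally have "p dvd fact m * fact (n - m) * (n choose m)" .
      moreover have "\<not> p dvd fact m" "\<not> p dvd fact (n - m)"
        using p 4 prime_dvd_fact_iff[of p m] prime_dvd_fact_iff[of p "n - m"] by auto
      ultimately show "p dvd n choose m"
        using p by (auto simp: prime_dvd_mult_iff)
    qed auto
    then have "\<Prod>?Q \<le> n choose m"
      using 4 by (intro dvd_imp_le) auto
    then have "\<Prod>?Q \<le> 4 ^ m"
      using binomial_odd_middle_le[of m] 4 by simp
    also have "(4::nat) ^ (m + 1) * 4 ^ m = 4 ^ n"
      using 4 by (simp add: mult_2 flip: power_add)
    finally show ?thesis by simp
  qed
qed

text \<open>With \<open>I m k = 1 / (k * (m choose k))\<close>, the Beta integral of \<open>x^(k-1) (1-x)^(m-k)\<close>, one has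
  \<open>I m (k + 1) = I (m - 1) k - I m k\<close>, so divisibility propagates from \<open>k = 1\<close>.\<close>
lemma times_binomial_dvd:
  fixes D :: int
  assumes "\<And>i. 1 \<le> i \<Longrightarrow> i \<le> m \<Longrightarrow> int i dvd D" "k < m"
  shows "int (Suc k * (m choose Suc k)) dvd D"
  using assms
proof (induction k arbitrary: m)
  case 0
  then show ?case by simp
next
  case (Suc k)
  define j where "j = Suc k"
  obtain l where l: "m = Suc l" using Suc.prems by (cases m) auto
  have jl: "j \<le> l" "0 < j" using Suc.prems l by (auto simp: j_def)
  have "int (j * (m choose j)) dvd D" "int (j * (l choose j)) dvd D"
    using Suc.IH[of m] Suc.IH[of l] Suc.prems l by (auto simp: j_def)
  then obtain a b where a: "D = int (j * (m choose j)) * a" and b: "D = int (j * (l choose j)) * b"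
    by (meson dvdE)
  define x y z where "x = real (l choose j)" and "y = real (m choose j)"
    and "z = real (m choose Suc j)"
  have pos: "x > 0" "y > 0" "z > 0" "real j > 0"
    using jl l by (auto simp: x_def y_def z_def simp del: binomial_Suc_Suc)
  have 1: "real (Suc j) * z = real (Suc l) * x"
    using binomial_absorption[of j l] unfolding x_def z_def l
    by (metis of_nat_mult Suc_times_binomial)
  have 2: "real (Suc j) * z = (real (Suc l) - real j) * y"
  proof -
    have "Suc j * (m choose Suc j) = (m - j) * (m choose j)"
      using binomial_absorb_comp[of m j] Suc_times_binomial[of j l]  unfolding l by simp
    then show ?thesis unfolding y_def z_def using jl l
      by (metis of_nat_mult of_nat_diff le_SucI)
  qed
  have a': "real_of_int D = j * y * a" and b': "real_of_int D = j * x * b"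
    unfolding x_def y_def by (subst a, simp) (subst b, simp)
  \<comment> \<open>Since \<open>a = D * I m j\<close> and \<open>b = D * I l j\<close>, the
    recurrence reads \<open>D * I m (j + 1) = b - a\<close>.\<close>
  have "real_of_int D = real (Suc j) * z * (b - a)"
  proof -
    have "real (Suc j) * z * b = real (Suc l) * (x * b)" by (simp only: 1 mult.assoc)
    also have "x * b = D / j" using b' pos by simp
    finally have e1: "real (Suc j) * z * b = real (Suc l) * D / j" by simp
    have "real (Suc j) * z * a = (real (Suc l) - real j) * (y * a)" by (simp only: 2 mult.assoc)
    also have "y * a = D / j" using a' pos by simp
    finally have e2: "real (Suc j) * z * a = (real (Suc l) - real j) * D / j" by simp
    show ?thesis unfolding of_int_diff right_diff_distrib e1 e2 using pos by (simp add: field_simps)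
  qed
  then have "real_of_int D = real_of_int (int (Suc j * (m choose Suc j)) * (b - a))"
    unfolding z_def by (simp add: algebra_simps)
  then have "D = int (Suc j * (m choose Suc j)) * (b - a)" 
    by (simp only: of_int_eq_iff)
  then show ?case unfolding j_def by (metis dvd_triv_left)
qed

section \<open>Prime powers dividing least common multiples and binomial coefficients\<close>

lemma prime_power_dvd_lcm:
  fixes p :: nat
  assumes "prime p" "p ^ v dvd lcm a b"
  shows "p ^ v dvd a \<or> p ^ v dvd b"
proof (cases "a = 0 \<or> b = 0")
  case False
  then have "multiplicity p (lcm a b) = max (multiplicity p a) (multiplicity p b)"
    using assms by (intro multiplicity_lcm) auto
  moreover have "v \<le> multiplicity p (lcm a b)"
    using assms False by (intro multiplicity_geI) auto
  ultimately show ?thesis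
    by (auto simp: max_def multiplicity_dvd' split: if_splits)
qed auto

lemma prime_power_dvd_Lcm_le:
  fixes p :: nat
  assumes "prime p" "p ^ v dvd Lcm {1..m}" "m \<ge> 1"
  shows "p ^ v \<le> m"
  using assms(2,3)
proof (induction m)
  case (Suc m)
  show ?case
  proof (cases "m = 0")
    case True
    then have "p ^ v dvd 1" using Suc.prems by (simp only: One_nat_def atLeastAtMost_singleton) simp
    then have "p ^ v \<le> 1" by (rule dvd_imp_le) simp
    then show ?thesis using True by simp
  next
    case False
    have "p ^ v dvd lcm (Suc m) (Lcm {1..m})"
      using Suc.prems by (simp add: atLeastAtMostSuc_conv)
    then consider "p ^ v dvd Suc m" | "p ^ v dvd Lcm {1..m}"
      using prime_power_dvd_lcm[OF assms(1)] by blast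
    then show ?thesis
      using Suc.IH False by cases (auto dest: dvd_imp_le)
  qed
qed simp

text \<open>Takes the place of Legendre's formula: \<open>m choose k\<close> divides
  \<open>Lcm {1..m}\<close> by \<open>times_binomial_dvd\<close>.\<close>

lemma prime_power_dvd_binomial_le:
  fixes p :: nat
  assumes "prime p" "p ^ v dvd (m choose k)" "k \<le> m" "m \<ge> 1"
  shows "p ^ v \<le> m"
proof (cases k)
  case 0
  then have "p ^ v \<le> 1" using assms by (intro dvd_imp_le) auto
  then show ?thesis using assms by linarith
next
  case (Suc j)
  have "int (Suc j * (m choose Suc j)) dvd int (Lcm {1..m})"
    by (rule times_binomial_dvd) (use assms Suc in \<open>auto simp: int_dvd_int_iff intro: dvd_Lcm\<close>)
  then have "Suc j * (m choose Suc j) dvd Lcm {1..m}"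
    by (simp only: int_dvd_int_iff)
  then have "p ^ v dvd Lcm {1..m}"
    using assms(2) Suc by (meson dvd_mult dvd_trans)
  then show ?thesis
    using prime_power_dvd_Lcm_le assms by blast
qed

text \<open>Only \<open>2 * p\<close> among \<open>n + 1, ..., 2 * n\<close> is a multiple of
  \<open>p\<close>, and \<open>p\<close> is odd, so \<open>p\<close> occurs exactly once in their
  product. That product is \<open>fact n * (2 * n choose n)\<close>, and \<open>fact n\<close>
  already contains \<open>p\<close>.\<close>

lemma not_dvd_central_binomial:
  assumes p: "prime p" "2 * n < 3 * p" "p \<le> n" "n \<ge> 3"
  shows "\<not> p dvd (2 * n choose n)"
proof
  assume "p dvd (2 * n choose n)"
  moreover have "p dvd fact n" using p by (simp add: prime_dvd_fact_iff)
  ultimately have "p * p dvd fact n * (2 * n choose n)"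
    by (simp add: mult_dvd_mono)
  also have "fact n * (2 * n choose n) = \<Prod>{n+1..2*n}"
  proof -
    have "fact n * (fact n * (2 * n choose n)) = fact (2 * n)"
      using binomial_fact_lemma[of n "2 * n"] by (simp add: mult.assoc)
    also have "{1..2*n} = {1..n} \<union> {n+1..2*n}" by auto
    then have "fact (2 * n) = fact n * \<Prod>{n+1..2*n}"
      by (simp add: fact_prod prod.union_disjoint)
    finally show ?thesis by simp
  qed
  also have "\<dots> = 2 * p * \<Prod>({n+1..2*n} - {2 * p})"
    using p by (subst prod.remove[of _ "2 * p"]) auto
  finally have "p dvd 2 * \<Prod>({n+1..2*n} - {2 * p})"
    using p by (auto simp: mult.assoc mult.left_commute dvd_mult_cancel1 prime_gt_0_nat)
  then have "p dvd 2 \<or> (\<exists>i\<in>{n+1..2*n} - {2 * p}. p dvd i)"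
    using p by (simp add: prime_dvd_mult_iff prime_dvd_prod_iff)
  then consider "p dvd 2" | i where "i \<in> {n+1..2*n} - {2 * p}" "p dvd i"
    by blast
  then show False
  proof cases
    case 1
    then show False using p by (auto dest: dvd_imp_le)
  next
    case 2
    then obtain t where t: "i = p * t" by (elim dvdE)
    have "t < 3"
    proof (rule ccontr)
      assume "\<not> t < 3"
      then have "p * 3 \<le> p * t" by simp
      moreover have "p * t \<le> 2 * n" using 2 t by simp
      ultimately show False using p by linarith
    qed
    moreover have "t \<noteq> 2" "t \<noteq> 0" using 2 t by (auto intro: Nat.gr0I)
    ultimately have "t = 1" by auto
    then show False using 2 t p by auto
  qed
qed

section \<open>Erdos' estimate and the postulate\<close>

text \<open>In logarithms, \<open>(y + 1) * 2 * ln y < y * y * L / 3\<close> suffices. The threshold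
  \<open>512\<close> gives \<open>y \<ge> 32 = 2 ^ 5\<close>; writing \<open>y = 32 + t\<close> and
  bounding \<open>ln y\<close> by its tangent at \<open>32\<close> leaves a polynomial in
  \<open>t\<close>, whose coefficients are positive because
  \<open>L = ln 2 \<ge> 2 / 3\<close>.\<close>

lemma erdos_inequality:
  fixes n r :: nat
  assumes n: "n \<ge> 512" and r: "r * r \<le> 2 * n"
  shows "2 * n * (2 * n) ^ r * 4 ^ (2 * n div 3) < 4 ^ n"
proof -
  define y where "y = sqrt (2 * real n)"
  define L where "L = ln (2 :: real)"
  define t where "t = y - 32"
  have yy: "y * y = 2 * real n" by (simp add: y_def)
  have "sqrt 1024 \<le> y" unfolding y_def by (rule real_sqrt_le_mono) (use n in auto)
  moreover have "sqrt 1024 = (32::real)" by (rule real_sqrt_unique) auto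
  ultimately have t: "t \<ge> 0" by (simp add: t_def)
  have y: "y = 32 + t" by (simp add: t_def)
  have L: "L \<ge> 2 / 3" using ln2_ge_two_thirds by (simp add: L_def)
  have "real (r * r) \<le> real (2 * n)" using r of_nat_le_iff by blast
  then have ry: "real r \<le> y"
    unfolding y_def by (intro real_le_rsqrt) (simp add: power2_eq_square)
  have l2n: "ln (2 * real n) = 2 * ln y"
    using yy y t by (metis ln_mult_pos add_pos_nonneg mult_2 zero_less_numeral)
  have "ln y = ln 32 + ln (1 + t / 32)"
    using t by (simp add: y flip: ln_mult_pos)
  also have "ln (32::real) = 5 * L"
    unfolding L_def using ln_realpow[of 2 5] by simp
  also have "ln (1 + t / 32) \<le> t / 32" using t by (intro ln_add_one_self_le_self) auto
  finally have ly: "ln y \<le> 5 * L + t / 32" by simp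
  have lnpos: "0 \<le> ln y" using y t by simp
  have "(real r + 1) * ln (2 * real n) \<le> (y + 1) * (2 * (5 * L + t / 32))"
    unfolding l2n using ry ly lnpos y t by (intro mult_mono) auto
  also have "\<dots> < y * y * L / 3"
  proof -
    have "y * y * L / 3 - (y + 1) * (2 * (5 * L + t / 32)) =
        34 / 3 * L + t * (34 / 3 * L - 66 / 32) + t * t * (L / 3 - 1 / 16)"
      unfolding y by (simp add: field_simps)
    moreover have "t * (34 / 3 * L - 66 / 32) \<ge> 0" "t * t * (L / 3 - 1 / 16) \<ge> 0"
      using t L by (auto intro!: mult_nonneg_nonneg)
    ultimately show ?thesis using L by linarith
  qed
  also have "y * y * L / 3 = 2 * L * (real n - 2 * real n / 3)" unfolding yy by simp
  also have "\<dots> \<le> 2 * L * (real n - real (2 * n div 3))"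
    using L of_nat_div_le_of_nat[of "2 * n" 3, where ?'a = real] by (intro mult_left_mono) auto
  finally have main: "(real r + 1) * ln (2 * real n) + 2 * L * real (2 * n div 3) < 2 * L * real n"
    by (simp add: right_diff_distrib)
  have ln4: "ln (4 :: real) = 2 * L" unfolding L_def using ln_realpow[of 2 2] by simp
  have "ln (real (2 * n * (2 * n) ^ r * 4 ^ (2 * n div 3))) < ln (real (4 ^ n))"
    using main n by (simp add: ln_mult_pos ln_realpow ln4 algebra_simps)
  then have "real (2 * n * (2 * n) ^ r * 4 ^ (2 * n div 3)) < real (4 ^ n)"
    using n by (subst (asm) ln_less_cancel_iff) auto
  then show ?thesis by (simp only: of_nat_less_iff)
qed

text \<open>Without such a prime, all prime factors of \<open>C\<close> are at most
  \<open>2 * n / 3\<close>. Those up to \<open>sqrt (2 * n)\<close> contribute at most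
  \<open>2 * n\<close> each; the larger ones occur once and fall under the primorial bound. This
  pushes \<open>C\<close> below its lower bound \<open>4 ^ n / (2 * n)\<close>.\<close>

lemma bertrand_large:
  fixes n :: nat
  assumes n: "n \<ge> 512"
  shows "\<exists>p. prime p \<and> n < p \<and> p \<le> 2 * n"
proof (rule ccontr)
  assume "\<not> ?thesis"
  then have no: "\<And>p. prime p \<Longrightarrow> p \<le> 2 * n \<Longrightarrow> p \<le> n" by (meson not_le)
  define C where "C = (2 * n choose n)"
  define r where "r = floor_sqrt (2 * n)"
  let ?S = "{p \<in> prime_factors C. p \<le> r}" and ?T = "{p \<in> prime_factors C. r < p}"
  have C0: "C > 0" by (simp add: C_def)
  have pow: "p ^ multiplicity p C \<le> 2 * n" if "p \<in> prime_factors C" for p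
    by (rule prime_power_dvd_binomial_le[of _ _ _ n])
      (use that n in \<open>auto simp: C_def multiplicity_dvd in_prime_factors_iff\<close>)
  have range: "p \<le> 2 * n div 3" if "p \<in> prime_factors C" for p
  proof (rule ccontr)
    assume *: "\<not> p \<le> 2 * n div 3"
    have p: "prime p" "p dvd C" using that by auto
    have "p ^ 1 \<le> 2 * n"
      by (rule prime_power_dvd_binomial_le[of _ _ _ n]) (use p n in \<open>auto simp: C_def\<close>)
    then have "p \<le> n" using no p by simp
    then show False using not_dvd_central_binomial[of p n] * p n by (auto simp: C_def)
  qed
  have "prime_factors C = ?S \<union> ?T" by auto
  then have "C = (\<Prod>p\<in>?S \<union> ?T. p ^ multiplicity p C)"
    using prime_factorization_nat[OF C0] by simp
  also have "\<dots> = (\<Prod>p\<in>?S. p ^ multiplicity p C) * (\<Prod>p\<in>?T. p ^ multiplicity p C)"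
    by (intro prod.union_disjoint) auto
  also have "(\<Prod>p\<in>?S. p ^ multiplicity p C) \<le> (2 * n) ^ r"
  proof -
    have "(\<Prod>p\<in>?S. p ^ multiplicity p C) \<le> (\<Prod>p\<in>?S. 2 * n)"
      using pow by (intro prod_mono) auto
    also have "\<dots> = (2 * n) ^ card ?S" by simp
    also have "card ?S \<le> card {1..r}"
      by (intro card_mono) (auto simp: in_prime_factors_iff Suc_le_eq prime_gt_0_nat)
    then have "(2 * n) ^ card ?S \<le> (2 * n) ^ r"
      using n by (intro power_increasing) auto
    finally show ?thesis .
  qed
  also have "(\<Prod>p\<in>?T. p ^ multiplicity p C) \<le> 4 ^ (2 * n div 3)"
  proof -
    have "multiplicity p C \<le> 1" if p: "p \<in> ?T" for p
    proof (rule ccontr)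
      assume "\<not> multiplicity p C \<le> 1"
      then have "p ^ 2 \<le> p ^ multiplicity p C"
        using p by (intro power_increasing) (auto simp: in_prime_factors_iff Suc_le_eq prime_gt_0_nat)
      also have "\<dots> \<le> 2 * n" using pow p by auto
      finally have "p \<le> r" unfolding r_def by (simp add: le_floor_sqrt_iff)
      then show False using p by simp
    qed
    then have "(\<Prod>p\<in>?T. p ^ multiplicity p C) \<le> (\<Prod>p\<in>?T. p ^ 1)"
      by (intro prod_mono conjI power_increasing)
        (auto simp: in_prime_factors_iff Suc_le_eq prime_gt_0_nat)
    also have "\<dots> = \<Prod>?T" by simp
    also have "\<Prod>?T dvd \<Prod>{p. prime p \<and> p \<le> 2 * n div 3}"
      by (rule prod_dvd_prod_subset) (use range in auto)
    then have "\<Prod>?T \<le> \<Prod>{p. prime p \<and> p \<le> 2 * n div 3}"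
      by (intro dvd_imp_le) (auto intro: prod_pos prime_gt_0_nat)
    also have "\<dots> \<le> 4 ^ (2 * n div 3)" by (rule primorial_le)
    finally show ?thesis .
  qed
  finally have C: "C \<le> (2 * n) ^ r * 4 ^ (2 * n div 3)" by (simp add: mult_mono)
  have "4 ^ n / real (2 * n) \<le> real C"
    using central_binomial_lower_bound[of n] n by (simp add: C_def)
  then have "real (4 ^ n) \<le> real (2 * n * C)" using n by (simp add: field_simps)
  then have "4 ^ n \<le> 2 * n * C" by (simp only: of_nat_le_iff)
  also have "\<dots> \<le> 2 * n * ((2 * n) ^ r * 4 ^ (2 * n div 3))" using C by (rule mult_le_mono2)
  also have "\<dots> < 4 ^ n"
    using erdos_inequality[OF n, of r] by (simp add: mult.assoc r_def flip: power2_eq_square)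
  finally show False by simp
qed

text \<open>Below the threshold a chain of primes suffices, each less than twice its
  predecessor.\<close>

lemma bertrand_postulate:
  fixes n :: nat
  assumes "n \<ge> 1"
  shows "\<exists>p. prime p \<and> n < p \<and> p \<le> 2 * n"
proof -
  have pr: "prime (2::nat)" "prime (3::nat)" "prime (5::nat)" "prime (7::nat)" "prime (13::nat)"
    "prime (23::nat)" "prime (43::nat)" "prime (83::nat)" "prime (163::nat)" "prime (317::nat)"
    "prime (631::nat)"
    by (simp_all add: upt_rec_numeral)
  consider "n < 2" | "2 \<le> n" "n < 3" | "3 \<le> n" "n < 5" | "5 \<le> n" "n < 7" | "7 \<le> n" "n < 13"
    | "13 \<le> n" "n < 23" | "23 \<le> n" "n < 43" | "43 \<le> n" "n < 83" | "83 \<le> n" "n < 163"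
    | "163 \<le> n" "n < 317" | "317 \<le> n" "n < 631" | "512 \<le> n"
    by linarith
  then show ?thesis
    by cases (use assms bertrand_large in \<open>
      auto intro: exI[of _ 2] exI[of _ 3] exI[of _ 5] exI[of _ 7] exI[of _ 13] exI[of _ 23]
        exI[of _ 43] exI[of _ 83] exI[of _ 163] exI[of _ 317] exI[of _ 631] simp: pr
        simp del: prime_nat_numeral_eq\<close>)
qed

subsection \<open>Optimal sets of primes\<close>

text \<open>The upper bound is made for \<open>missing_primes_near\<close>: \<open>b * m < c\<close>
  then yields \<open>b + q \<le> c\<close>. Bertrand's postulate at \<open>m + b - 1\<close> is good
  enough for \<open>b \<ge> 4\<close>; smaller \<open>b\<close> are treated separately.\<close>

lemma prime_between_sum_and_product:
  fixes b m :: nat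
  assumes b: "prime b" and m: "prime m" and "b < m"
  shows "\<exists>q. prime q \<and> b + m \<le> q \<and> q + b \<le> b * m + 1"
proof -
  have b2: "b \<ge> 2" using b by (rule prime_ge_2_nat)
  have "odd m" using m b2 \<open>b < m\<close> by (intro prime_odd_nat) auto
  consider "b = 2" | "b = 3" "m = 5" | "b = 3" "m \<ge> 7" | "b \<ge> 4"
  proof -
    assume *: "b = 2 \<Longrightarrow> thesis" "b = 3 \<Longrightarrow> m = 5 \<Longrightarrow> thesis"
      "b = 3 \<Longrightarrow> m \<ge> 7 \<Longrightarrow> thesis" "b \<ge> 4 \<Longrightarrow> thesis"
    have "m \<noteq> 4" "m \<noteq> 6" using \<open>odd m\<close> by auto
    then have "b = 2 \<or> b = 3 \<and> m = 5 \<or> b = 3 \<and> m \<ge> 7 \<or> b \<ge> 4"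
      using b2 \<open>b < m\<close> by arith
    then show thesis using * by blast
  qed
  then show ?thesis
  proof cases
    case 1
    obtain q where q: "prime q" "m < q" "q \<le> 2 * m"
      using bertrand_postulate[of m] \<open>b < m\<close> by auto
    \<comment> \<open>Parity excludes \<open>m + 1\<close> and \<open>2 * m\<close>, which sharpens
      the range to \<open>m + 2 \<le> q \<le> 2 * m - 1\<close>.\<close>
    then have "odd q" using 1 \<open>b < m\<close> by (intro prime_odd_nat) auto
    then have "q \<noteq> m + 1" "q \<noteq> 2 * m" using \<open>odd m\<close> by auto
    then show ?thesis using q 1 by (intro exI[of _ q]) auto
  next
    case 2
    then show ?thesis by (intro exI[of _ 11]) (auto simp: upt_rec_numeral)
  next
    case 3
    obtain q where q: "prime q" "m + 2 < q" "q \<le> 2 * (m + 2)"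
      using bertrand_postulate[of "m + 2"] by auto
    then show ?thesis using 3 by (intro exI[of _ q]) auto
  next
    case 4
    have "1 \<le> m + b - 1" using 4 by linarith
    then obtain q where q: "prime q" "m + b - 1 < q" "q \<le> 2 * (m + b - 1)"
      using bertrand_postulate by blast
    obtain d where d: "b = 4 + d" using 4 le_Suc_ex by blast
    obtain e where e: "m = Suc (b + e)" using \<open>b < m\<close> less_imp_Suc_add by blast
    have "2 * (m + b - 1) + b \<le> b * m + 1"
      unfolding e unfolding d by (simp add: algebra_simps)
    then show ?thesis using q b2 by (intro exI[of _ q]) auto
  qed
qed

text \<open>Elements are collected until the weight reaches \<open>b\<close> or none is left; the
  last one collected is the \<open>i\<close> whose removal drops the sum below
  \<open>b\<close>.\<close>

lemma ex_subset_crossing: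
  fixes w :: "'a \<Rightarrow> nat"
  assumes "finite C"
  shows "\<exists>I\<subseteq>C. (b \<le> sum w I \<or> I = C) \<and> (I = {} \<or> (\<exists>i\<in>I. sum w (I - {i}) < b))"
  using assms
proof (induction C rule: finite_induct)
  case (insert c C)
  then obtain I where I: "I \<subseteq> C" "b \<le> sum w I \<or> I = C"
    "I = {} \<or> (\<exists>i\<in>I. sum w (I - {i}) < b)" by blast
  show ?case
  proof (cases "b \<le> sum w I")
    case True
    then show ?thesis using I by blast
  next
    case False
    with I insert.hyps have "sum w (insert c C - {c}) < b" by simp
    then show ?thesis by (intro exI[of _ "insert c C"]) blast
  qed
qed auto

text \<open>Each ratio satisfies \<open>g i / f i \<le> 1 + (g i - f i) / L \<le> exp ((g i - f i) /
  L)\<close>, so their product is less than \<open>exp 1 \<le> 3\<close>. Truncated subtraction is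
  harmless: where \<open>g i < f i\<close> the bound is \<open>1\<close>.\<close>

lemma prod_less_3_times_prod:
  fixes f g :: "'a \<Rightarrow> nat"
  assumes "finite J" and L: "\<And>i. i \<in> J \<Longrightarrow> L \<le> f i"
    and "(\<Sum>i\<in>J. g i - f i) < L"
  shows "prod g J < 3 * prod f J"
proof -
  have L0: "L > 0" using assms(3) by simp
  have "real (prod g J) \<le> (\<Prod>i\<in>J. real (f i) * exp (real (g i - f i) / real L))"
    unfolding of_nat_prod
  proof (intro prod_mono conjI)
    fix i assume i: "i \<in> J"
    have "real (g i) \<le> real (f i) + real (g i - f i)" by linarith
    also have "real (g i - f i) \<le> real (f i) * (real (g i - f i) / real L)"
      using L[OF i] L0 by (simp add: field_simps mult_right_mono)
    also have "real (f i) + \<dots> = real (f i) * (1 + real (g i - f i) / real L)"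
      by (simp add: algebra_simps)
    also have "\<dots> \<le> real (f i) * exp (real (g i - f i) / real L)"
      by (intro mult_left_mono exp_ge_add_one_self) auto
    finally show "real (g i) \<le> real (f i) * exp (real (g i - f i) / real L)" by simp
  qed auto
  also have "\<dots> = real (prod f J) * exp (real (\<Sum>i\<in>J. g i - f i) / real L)"
    using \<open>finite J\<close> by (simp add: prod.distrib exp_sum sum_divide_distrib)
  also have "\<dots> < real (prod f J) * 3"
  proof (rule mult_strict_left_mono)
    have "exp (real (\<Sum>i\<in>J. g i - f i) / real L) < exp 1"
      using assms(3) L0 by (subst exp_less_cancel_iff) (simp only: divide_less_eq_1_pos of_nat_0_less_iff of_nat_less_iff)
    also have "\<dots> \<le> 3" by (rule exp_le)
    finally show "exp (real (\<Sum>i\<in>J. g i - f i) / real L) < 3" .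
    have "f i > 0" if "i \<in> J" for i using L[OF that] L0 by simp
    then show "0 < real (prod f J)" by (simp add: prod_pos)
  qed
  finally have "real (prod g J) < real (3 * prod f J)" by simp
  then show ?thesis by (simp only: of_nat_less_iff)
qed

section \<open>Exchange arguments in an optimal set\<close>

text \<open>A squarefree number is represented by its set of prime factors, so that exchanging
  factors is a set operation.\<close>

locale optimal_primes =
  fixes n :: nat and A :: "nat set"
  assumes finite: "finite A"
    and prime: "\<And>p. p \<in> A \<Longrightarrow> prime p"
    and sum_le: "\<Sum>A \<le> n"
    and maximal: "\<And>B. finite B \<Longrightarrow> (\<And>p. p \<in> B \<Longrightarrow> prime p) \<Longrightarrow> \<Sum>B \<le> n \<Longrightarrow> \<Prod>B \<le> \<Prod>A"
begin

text \<open>The set with \<open>X\<close> replaced by \<open>Y\<close> competes with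
  \<open>A\<close>; the common factor \<open>\<Prod>(A - X)\<close> cancels.\<close>

lemma exchange:
  assumes "X \<subseteq> A" "finite Y" "\<And>p. p \<in> Y \<Longrightarrow> prime p" "Y \<inter> A = {}" "\<Sum>(A - X) + \<Sum>Y \<le> n"
  shows "\<Prod>Y \<le> \<Prod>X"
proof -
  have "\<Prod>(A - X) * \<Prod>Y = \<Prod>((A - X) \<union> Y)"
    using assms finite by (intro prod.union_disjoint [symmetric]) auto
  also have "\<dots> \<le> \<Prod>A"
  proof (rule maximal)
    have "\<Sum>((A - X) \<union> Y) = \<Sum>(A - X) + \<Sum>Y"
      using assms finite by (intro sum.union_disjoint) auto
    then show "\<Sum>((A - X) \<union> Y) \<le> n" using assms by simp
  qed (use assms finite prime in auto)
  also have "\<Prod>A = \<Prod>(A - X) * \<Prod>X"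
    using assms finite by (metis prod.subset_diff)
  finally have "\<Prod>(A - X) * \<Prod>Y \<le> \<Prod>(A - X) * \<Prod>X" .
  moreover have "\<Prod>(A - X) > 0" using prime by (intro prod_pos) (auto simp: prime_gt_0_nat)
  ultimately show ?thesis by simp
qed

lemma split_prime:
  assumes "c \<in> A" "prime b" "b \<notin> A" "prime s" "s \<notin> A" "s \<noteq> b" "b + s \<le> c"
  shows "b * s < c"
proof -
  have "\<Sum>A = \<Sum>(A - {c}) + c"
    using assms finite by (simp add: sum.remove)
  then have "\<Prod>{b, s} \<le> \<Prod>{c}"
    using assms sum_le by (intro exchange) auto
  \<comment> \<open>The exchange gives only \<open>b * s \<le> c\<close>; equality would make the
    prime \<open>c\<close> composite.\<close>
  moreover have "b * s \<noteq> c"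
    using assms prime[of c] prime_product[of b s] by (auto dest: prime_gt_1_nat)
  ultimately show ?thesis using assms by simp
qed

lemma missing_primes_near:
  assumes b: "prime b" "b \<notin> A" and least: "\<And>s. prime s \<Longrightarrow> s \<notin> A \<Longrightarrow> b \<le> s"
    and c: "c \<in> A" and s: "prime s" "s \<notin> A" "s \<noteq> b"
  shows "c < b + s"
proof (rule ccontr)
  assume "\<not> c < b + s"
  then have bs: "b * s < c" using split_prime[of c b s] assms by simp
  define S where "S = {s. prime s \<and> s \<notin> A \<and> s \<noteq> b \<and> b * s < c}"
  have "b \<ge> 2" using b by (simp add: prime_ge_2_nat)
  have "s \<le> c" if "b * s < c" for s
    using that \<open>b \<ge> 2\<close> mult_le_mono1[of 1 b s] by linarith
  then have "S \<subseteq> {..c}" by (auto simp: S_def)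
  then have fin: "finite S" by (rule finite_subset) simp
  have "S \<noteq> {}" using s bs by (auto simp: S_def)
  define m where "m = Max S"
  have "m \<in> S" unfolding m_def using fin \<open>S \<noteq> {}\<close> by (rule Max_in)
  then have m: "prime m" "m \<notin> A" "m \<noteq> b" "b * m < c" by (auto simp: S_def)
  then have "b < m" using least[of m] by simp
  obtain q where q: "prime q" "b + m \<le> q" "q + b \<le> b * m + 1"
    using prime_between_sum_and_product[OF b(1) m(1) \<open>b < m\<close>] by blast
  show False
  proof (cases "q \<in> A")
    case True
    then have "b * m < q" using split_prime[of q b m] b m q by simp
    then show False using q \<open>b \<ge> 2\<close> by simp
  next
    case False
    \<comment> \<open>Here \<open>b + q \<le> b * m + 1 \<le> c\<close>, so \<open>c\<close> could
      be replaced by \<open>b\<close> and \<open>q\<close>.\<close>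
    then have "b * q < c" using split_prime[of c b q] b c q m \<open>b < m\<close> by simp
    then have "q \<in> S" using q False \<open>b < m\<close> by (auto simp: S_def)
    then have "q \<le> m" unfolding m_def using fin by simp
    then show False using q \<open>b \<ge> 2\<close> by simp
  qed
qed

text \<open>Each prime \<open>c\<close> of \<open>A\<close> above the initial segment \<open>P\<close> is paired with a missing prime \<open>f c\<close> of \<open>P\<close>.
  Replacing just enough of the \<open>c\<close> by \<open>f c\<close> frees room for the least missing prime \<open>b\<close>. As
  \<open>c < f c + b\<close>, this costs a factor of less than \<open>3\<close> for all but the last replacement and at
  most \<open>2 * b / (b + 1)\<close> for the last one.\<close>
lemma card_ge_initial_segment:
  assumes P: "finite P" "\<And>p. p \<in> P \<Longrightarrow> prime p" "\<Sum>P \<le> n"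
    and down: "\<And>p q. p \<in> P \<Longrightarrow> prime q \<Longrightarrow> q < p \<Longrightarrow> q \<in> P"
  shows "card P \<le> card A"
proof (rule ccontr)
  assume "\<not> card P \<le> card A"
  then have card: "card (A - P) < card (P - A)"
    using P finite by (intro card_less_sym_Diff) auto
  define b where "b = Min (P - A)"
  have "P - A \<noteq> {}" using card by (metis card.empty not_less0)
  then have bP: "b \<in> P - A" unfolding b_def using P by (intro Min_in) auto
  then have b: "prime b" "b \<notin> A" using P by auto
  have above: "p < c" if "p \<in> P" "prime c" "c \<notin> P" for p c
    using down[of p c] that by (cases p c rule: linorder_cases) auto
  \<comment> \<open>Primes outside \<open>P\<close> exceed all of \<open>P\<close>, so
    \<open>b\<close> is least among all missing primes.\<close>
  have least: "b \<le> s" if "prime s" "s \<notin> A" for s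
  proof (cases "s \<in> P")
    case True
    then show ?thesis unfolding b_def using that P by (intro Min_le) auto
  next
    case False
    then show ?thesis using above[of b s] bP that by simp
  qed
  have "card (A - P) \<le> card (P - A - {b})"
    using card bP P by (simp add: card_Diff_singleton)
  then obtain f where f: "f ` (A - P) \<subseteq> P - A - {b}" "inj_on f (A - P)"
    using card_le_inj[of "A - P" "P - A - {b}"] P finite by auto
  \<comment> \<open>The last two bounds hold for every \<open>c'\<close> in \<open>A - P\<close>,
    not only for \<open>c\<close>; this pins down \<open>I\<close> when
    \<open>b = 3\<close>.\<close>
  have fp: "prime (f c)" "f c \<notin> A" "f c \<in> P" "b < f c" "f c < c'" "c' < b + f c"
    if "c \<in> A - P" "c' \<in> A - P" for c c'
  proof -
    show f': "prime (f c)" "f c \<notin> A" "f c \<in> P" using f that P by auto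
    have "f c \<noteq> b" using f that by auto
    then show "b < f c" using least f' by (simp add: order.not_eq_order_implies_strict)
    show "f c < c'" using above f' that prime by simp
    show "c' < b + f c"
      using missing_primes_near[OF b least _ f'(1,2) \<open>f c \<noteq> b\<close>] that by blast
  qed
  obtain I where I: "I \<subseteq> A - P" "b \<le> (\<Sum>c\<in>I. c - f c) \<or> I = A - P"
    "I = {} \<or> (\<exists>i\<in>I. (\<Sum>c\<in>I - {i}. c - f c) < b)"
    using ex_subset_crossing[of "A - P" b "\<lambda>c. c - f c"] finite by auto
  have finI: "finite I" using I finite by (meson finite_Diff finite_subset)
  have injI: "inj_on f I" using f I by (meson inj_on_subset)
  have bI: "b \<notin> f ` I" using f I by auto
  have sumY: "\<Sum>(insert b (f ` I)) = b + (\<Sum>c\<in>I. f c)"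
    using finI injI bI by (simp add: sum.reindex)
  have "\<Prod>(insert b (f ` I)) \<le> \<Prod>I"
  proof (rule exchange)
    show "insert b (f ` I) \<inter> A = {}" using b f I by auto
    show "prime p" if "p \<in> insert b (f ` I)" for p using that b f I P by auto
    show "\<Sum>(A - I) + \<Sum>(insert b (f ` I)) \<le> n"
      using I(2)
    proof
      assume "b \<le> (\<Sum>c\<in>I. c - f c)"
      then have "b + (\<Sum>c\<in>I. f c) \<le> (\<Sum>c\<in>I. c - f c) + (\<Sum>c\<in>I. f c)" by simp
      also have "\<dots> = (\<Sum>c\<in>I. c)"
        unfolding sum.distrib[symmetric] using fp(5) I by (intro sum.cong) (auto simp: less_imp_le)
      finally have "\<Sum>(A - I) + \<Sum>(insert b (f ` I)) \<le> \<Sum>(A - I) + \<Sum>I"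
        unfolding sumY by simp
      also have "\<dots> = \<Sum>A" using I finite by (metis Diff_subset subset_trans sum.subset_diff)
      finally show ?thesis using sum_le by simp
    next
      \<comment> \<open>With all primes of \<open>A\<close> beyond \<open>P\<close> moved down, the
        new set lies inside \<open>P\<close>, whose sum is at most \<open>n\<close>.\<close>
      assume IA: "I = A - P"
      have "A - I = A \<inter> P" using IA by auto
      then have "\<Sum>(A - I) + \<Sum>(insert b (f ` I)) = \<Sum>(A \<inter> P \<union> insert b (f ` I))"
        using finite finI f I b by (subst sum.union_disjoint) auto
      also have "\<dots> \<le> \<Sum>P"
        using P bP f I by (intro sum_mono2) auto
      finally show ?thesis using P by simp
    qed
  qed (use I finI in auto)
  then have key: "b * (\<Prod>c\<in>I. f c) \<le> \<Prod>I"
    using finI injI bI by (simp add: prod.reindex)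
  have "b \<ge> 2" using b by (simp add: prime_ge_2_nat)
  have "I \<noteq> {}" using key \<open>b \<ge> 2\<close> by auto
  then obtain i where i: "i \<in> I" "(\<Sum>c\<in>I - {i}. c - f c) < b" using I by auto
  then have iA: "i \<in> A - P" using I by auto
  note fi = fp[OF iA iA]
  have key': "b * (f i * (\<Prod>c\<in>I - {i}. f c)) \<le> i * \<Prod>(I - {i})"
    using key prod.remove[OF finI i(1), of f] prod.remove[OF finI i(1), of "\<lambda>c. c"] by simp
  \<comment> \<open>Both primes exceed \<open>b \<ge> 2\<close>, hence are odd. This rules out
    \<open>b = 2\<close>, where \<open>f i < i < f i + 2\<close>.\<close>
  have gap: "c \<noteq> f c + 1" if c: "c \<in> A - P" for c
  proof -
    have "odd c" using prime[of c] fp[OF c c] c \<open>b \<ge> 2\<close> by (intro prime_odd_nat) auto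
    moreover have "odd (f c)" using fp[OF c c] \<open>b \<ge> 2\<close> by (intro prime_odd_nat) auto
    ultimately show ?thesis by (metis even_plus_one_iff)
  qed
  from gap[OF iA] have "b \<noteq> 2" using fi by auto
  moreover have "b \<noteq> 4" using b by auto
  ultimately consider "b = 3" | "b \<ge> 5" using \<open>b \<ge> 2\<close> by linarith
  then show False
  proof cases
    case 1
    \<comment> \<open>By parity every \<open>c\<close> in \<open>I\<close> is
      \<open>f c + 2\<close>, and the bounds between \<open>c\<close> and \<open>i\<close> in both
      directions force \<open>c = i\<close>. Then \<open>key'\<close> reads
      \<open>3 * f i \<le> f i + 2\<close>, which fails for \<open>f i > 3\<close>.\<close>
    have "c = i" if "c \<in> I" for c
    proof -
      have cA: "c \<in> A - P" using that I by auto
      have "c = f c + 2" "i = f i + 2"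
        using fp(5,6)[OF cA cA] fi 1 gap[OF iA] gap[OF cA] by auto
      then show ?thesis using fp(5,6)[OF cA iA] fp(5,6)[OF iA cA] 1 by simp
    qed
    then have "I = {i}" using i by blast
    then show False using key' fi 1 by simp
  next
    case 2
    \<comment> \<open>The replacements other than that of \<open>i\<close> cost a factor below
      \<open>3\<close>, by \<open>L = b + 1\<close>. From \<open>i \<le> f i + b - 1\<close> and
      \<open>f i \<ge> b + 1\<close> follows \<open>i / f i \<le> 2 * b / (b + 1)\<close>. The total
      cost stays below \<open>6 * b / (b + 1) \<le> b\<close>, contradicting
      \<open>key'\<close>.\<close>
    let ?F = "\<Prod>c\<in>I - {i}. f c"
    have G: "\<Prod>(I - {i}) < 3 * ?F"
    proof (rule prod_less_3_times_prod)
      show "b + 1 \<le> f c" if "c \<in> I - {i}" for c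
        using fp(4)[of c c] I that by auto
    qed (use finI i in auto)
    have "(b + 1) * i \<le> 2 * b * f i"
    proof -
      obtain u where u: "b = 1 + u" using \<open>b \<ge> 5\<close> le_Suc_ex[of 1 b] by auto
      obtain v where v: "f i = Suc (b + v)" using fi less_imp_Suc_add by blast
      have "(b + 1) * (f i + b - 1) \<le> 2 * b * f i"
        unfolding v unfolding u by (simp add: algebra_simps)
      moreover have "(b + 1) * i \<le> (b + 1) * (f i + b - 1)" using fi by (intro mult_le_mono2) auto
      ultimately show ?thesis by linarith
    qed
    then have "(b + 1) * (i * \<Prod>(I - {i})) \<le> 2 * b * f i * \<Prod>(I - {i})"
      by (metis mult.assoc mult_le_mono1)
    also have "\<dots> < 2 * b * f i * (3 * ?F)"
      using G fi \<open>b \<ge> 2\<close> by (intro mult_strict_left_mono) auto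
    also have "\<dots> = 6 * (b * (f i * ?F))" by simp
    finally have "(b + 1) * (b * (f i * ?F)) < 6 * (b * (f i * ?F))"
      using mult_le_mono2[OF key', of "b + 1"] by (rule le_less_trans [rotated])
    then have "b + 1 < 6" by (simp only: mult_less_cancel2)
    then show False using 2 by simp
  qed
qed

end

section \<open>Squarefree numbers as products of sets of primes\<close>

lemma prod_prime_factors_squarefree:
  fixes M :: nat
  assumes "0 < M" "squarefree M"
  shows "\<Prod>(prime_factors M) = M"
proof -
  have "multiplicity p M = 1" if "p \<in> prime_factors M" for p
    using assms that squarefree_factorial_semiring'[of M] by (auto simp: prime_factors_multiplicity)
  then have "\<Prod>(prime_factors M) = (\<Prod>p\<in>prime_factors M. p ^ multiplicity p M)"
    by (intro prod.cong) auto
  also have "\<dots> = M" using prime_factorization_nat[OF assms(1)] by simp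
  finally show ?thesis .
qed

lemma
  fixes B :: "nat set"
  assumes "finite B" "\<And>p. p \<in> B \<Longrightarrow> prime p"
  shows prime_factors_prod_primes: "prime_factors (\<Prod>B) = B"
    and squarefree_prod_primes: "squarefree (\<Prod>B)"
proof -
  have "0 \<notin> B" using assms(2) by force
  then have "prime_factors (\<Prod>B) = (\<Union>p\<in>B. prime_factors p)"
    using assms by (subst prime_factors_prod) auto
  then show "prime_factors (\<Prod>B) = B"
    using assms by (auto simp: prime_factorization_prime)
  show "squarefree (\<Prod>B)"
    using assms by (intro squarefree_prod_coprime) (auto intro: primes_coprime squarefree_prime)
qed

text \<open>Makes the maxima meaningful: a squarefree \<open>M\<close> is the product of its prime
  factors, each at most \<open>ell M\<close>.\<close>

lemma finite_squarefree_ell_le: "finite {M. 0 < M \<and> squarefree M \<and> ell M \<le> n}"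
proof (rule finite_subset)
  show "{M. 0 < M \<and> squarefree M \<and> ell M \<le> n} \<subseteq> Prod ` Pow {..n}"
  proof
    fix M assume "M \<in> {M. 0 < M \<and> squarefree M \<and> ell M \<le> n}"
    then have M: "0 < M" "squarefree M" "\<Sum>(prime_factors M) \<le> n" by (auto simp: ell_def)
    have "p \<le> n" if "p \<in> prime_factors M" for p
      using member_le_sum[of p "prime_factors M" "\<lambda>p. p"] that M by simp
    then have "prime_factors M \<in> Pow {..n}" by auto
    then show "M \<in> Prod ` Pow {..n}"
      using prod_prime_factors_squarefree[of M] M by (metis image_eqI)
  qed
qed auto

section \<open>Initial segments of the primes and their sums\<close>

abbreviation first_primes :: "nat \<Rightarrow> nat set" where
  "first_primes k \<equiv> enumerate {p. prime p} ` {..<k}"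

lemma
  shows first_primes_prime: "p \<in> first_primes k \<Longrightarrow> prime p"
    and card_first_primes: "card (first_primes k) = k"
    and sum_first_primes: "\<Sum>(first_primes k) = sigma k"
proof -
  show "p \<in> first_primes k \<Longrightarrow> prime p"
    using enumerate_in_set[OF primes_infinite] by auto
  have inj: "inj_on (enumerate {p::nat. prime p}) {..<k}"
    using strict_mono_enumerate[OF primes_infinite] by (meson strict_mono_imp_inj_on inj_on_subset subset_UNIV)
  then show "card (first_primes k) = k" by (simp add: card_image)
  show "\<Sum>(first_primes k) = sigma k"
    using inj by (simp add: sum.reindex sigma_def nth_prime_def sum.atLeast1_atMost_eq)
qed

lemma first_primes_initial:
  assumes "p \<in> first_primes k" "prime q" "q < p"
  shows "q \<in> first_primes k"
proof -
  obtain i where i: "p = enumerate {p. prime p} i" "i < k" using assms by auto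
  obtain j where j: "q = enumerate {p. prime p} j"
    using enumerate_Ex[of "{p. prime p}" q] primes_infinite assms by auto
  then have "j < i" using assms i primes_infinite by simp
  then show ?thesis using i j by auto
qed

text \<open>The first \<open>k\<close> primes missing from \<open>D\<close> inject into the part of
  \<open>D\<close> outside the initial segment, where every prime is larger.\<close>

lemma sigma_le_sum_primes:
  assumes "finite D" "\<And>p. p \<in> D \<Longrightarrow> prime p" "k \<le> card D"
  shows "sigma k \<le> \<Sum>D"
proof -
  let ?P = "first_primes k"
  have "card (?P - D) \<le> card (D - ?P)"
    using assms card_le_sym_Diff[of ?P D] by (simp add: card_first_primes)
  then obtain f where f: "f ` (?P - D) \<subseteq> D - ?P" "inj_on f (?P - D)"
    using card_le_inj[of "?P - D" "D - ?P"] assms by auto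
  have "\<Sum>(?P - D) \<le> (\<Sum>p\<in>?P - D. f p)"
  proof (rule sum_mono)
    fix p assume p: "p \<in> ?P - D"
    then have "f p \<in> D - ?P" using f by blast
    then show "p \<le> f p" using first_primes_initial[of p k "f p"] p assms by (meson DiffE leI)
  qed
  also have "\<dots> = \<Sum>(f ` (?P - D))" using f by (simp add: sum.reindex)
  also have "\<dots> \<le> \<Sum>(D - ?P)" using f assms by (intro sum_mono2) auto
  finally have "\<Sum>(?P - D) + \<Sum>(?P \<inter> D) \<le> \<Sum>(D - ?P) + \<Sum>(D \<inter> ?P)" by (simp add: Int_commute)
  then show ?thesis
    using assms by (simp add: sum.Int_Diff[symmetric] add.commute flip: sum_first_primes)
      (metis add.commute finite_imageI finite_lessThan sum.Int_Diff)
qed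

text \<open>\<open>sigma\<close> increases strictly from \<open>sigma 0 = 0\<close>, so exactly one
  \<open>k\<close> fits the description in \<open>kay\<close>.\<close>

lemma kay_works: "sigma (kay n) \<le> n \<and> n < sigma (kay n + 1)"
  unfolding kay_def
proof (rule theI')
  have Suc: "sigma k < sigma (Suc k)" for k
  proof -
    have "prime (nth_prime (Suc k))"
      using enumerate_in_set[OF primes_infinite, of k] by (simp add: nth_prime_def)
    then show ?thesis by (simp add: sigma_def prime_gt_0_nat)
  qed
  then have mono: "strict_mono sigma" by (simp add: strict_mono_Suc_iff)
  have ge: "k \<le> sigma k" for k using mono by (rule strict_mono_imp_increasing)
  show "\<exists>!k. sigma k \<le> n \<and> n < sigma (k + 1)"
  proof (rule ex_ex1I)
    have "n < sigma (Suc n)" using ge[of "Suc n"] by simp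
    then have ex: "\<exists>k. n < sigma k" ..
    define k where "k = (LEAST k. n < sigma k)"
    have k: "n < sigma k" unfolding k_def using ex by (rule LeastI_ex)
    then obtain j where j: "k = Suc j" by (cases k) (auto simp: sigma_def)
    have "\<not> n < sigma j" using not_less_Least[of j "\<lambda>k. n < sigma k"] j by (simp add: k_def)
    then show "\<exists>k. sigma k \<le> n \<and> n < sigma (k + 1)" using k j by (intro exI[of _ j]) auto
  next
    fix i j assume "sigma i \<le> n \<and> n < sigma (i + 1)" "sigma j \<le> n \<and> n < sigma (j + 1)"
    then have "sigma i < sigma (j + 1)" "sigma j < sigma (i + 1)" by auto
    then show "i = j" using strict_mono_less[OF mono] by simp
  qed
qed

theorem corollary6p1:
  fixes n :: nat
  assumes "n \<ge> 2"
  shows "max_prod n = max_prod_omega (kay n) n"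
proof -
  let ?S = "{M. 0 < M \<and> squarefree M \<and> ell M \<le> n}"
  let ?T = "{M. 0 < M \<and> squarefree M \<and> omega M = kay n \<and> ell M \<le> n}"
  define M where "M = Max ?S"
  have "1 \<in> ?S" by (simp add: ell_def)
  then have "?S \<noteq> {}" by blast
  with finite_squarefree_ell_le have "M \<in> ?S" unfolding M_def by (rule Max_in)
  then have M: "0 < M" "squarefree M" "\<Sum>(prime_factors M) \<le> n" by (auto simp: ell_def)
  interpret optimal_primes n "prime_factors M"
  proof
    fix B :: "nat set" assume B: "finite B" "\<And>p. p \<in> B \<Longrightarrow> prime p" "\<Sum>B \<le> n"
    then have "\<Prod>B \<in> ?S"
      using prime_factors_prod_primes[of B] squarefree_prod_primes[of B]
      by (auto simp: ell_def intro!: prod_pos prime_gt_0_nat)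
    with finite_squarefree_ell_le have "\<Prod>B \<le> M" unfolding M_def by (rule Max_ge)
    then show "\<Prod>B \<le> \<Prod>(prime_factors M)" using prod_prime_factors_squarefree M by simp
  qed (use M in auto)
  have "card (first_primes (kay n)) \<le> card (prime_factors M)"
    by (rule card_ge_initial_segment)
      (use kay_works[of n] in \<open>auto simp: sum_first_primes intro: first_primes_prime first_primes_initial\<close>)
  \<comment> \<open>More than \<open>kay n\<close> prime factors would sum to at least
    \<open>sigma (kay n + 1) > n\<close>.\<close>
  moreover have "card (prime_factors M) \<le> kay n"
  proof (rule ccontr)
    assume "\<not> ?thesis"
    then have "sigma (kay n + 1) \<le> \<Sum>(prime_factors M)"
      by (intro sigma_le_sum_primes) auto
    then show False using kay_works[of n] M by simp
  qed
  ultimately have "omega M = kay n" by (simp add: omega_def card_first_primes)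
  then have "M \<in> ?T" using \<open>M \<in> ?S\<close> by simp
  moreover have "N \<le> M" if "N \<in> ?T" for N
    unfolding M_def using that by (intro Max_ge finite_squarefree_ell_le) auto
  moreover have "finite ?T" by (rule finite_subset[OF _ finite_squarefree_ell_le]) auto
  ultimately have "Max ?T = M" by (intro Max_eqI) auto
  then show ?thesis by (simp add: max_prod_def max_prod_omega_def M_def)
qed

end
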